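(* Let $\lambda\in\mathbb{C}_p$ with $\lambda\ne0$ and $|\lambda|_p\le1$ ($p$ an odd prime). For every $n\ge0$ and $r\in\mathbb{N}$, \[ Ch^{(r)}_{n,\lambda}=\sum_{k=0}^n\sum_{m=0}^k(-1)^m\,m!\binom{r+m-1}{m}2^{-m}S_{2,\lambda}(k,m)\,S_1(n,k). \]
   Context: $S_1(n,k)$ are the signed Stirling numbers of the first kind: $x(x-1)\cdots(x-n+1)=\sum_{k=0}^nS_1(n,k)x^k$. The degenerate Stirling numbers of the second kind are defined by $\frac1{m!}\big((1+\lambda t)^{1/\lambda}-1\big)^m=\sum_{k\ge m}S_{2,\lambda}(k,m)\frac{t^k}{k!}$. Writing $(x)_{0,\lambda}=1$, $(x)_{n,\lambda}=x(x-\lambda)\cdots(x-(n-1)\lambda)$ and $(1+\lambda u)^{x/\lambda}=\sum_{m\ge0}(x)_{m,\lambda}u^m/m!$, the higher-order degenerate Changhee numbers of the second kind $Ch^{(r)}_{n,\lambda}$ are defined by $\left(\frac{2}{1+(1+\lambda\log(1+t))^{1/\lambda}}\right)^r=\sum_{n\ge0}Ch^{(r)}_{n,\lambda}\frac{t^n}{n!}$. *)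

theory Defs
  imports
    "HOL-Analysis.Abstract_Metric_Spaces"
    "HOL-Computational_Algebra.Formal_Power_Series"
    "HOL-Computational_Algebra.Polynomial"
    "HOL-Computational_Algebra.Primes"
begin

section \<open>The field of complex p-adic numbers\<close>

locale nonarchimedean_field =
  fixes pnorm :: "'a::field_char_0 \<Rightarrow> real"
  assumes pnorm_nonneg: "0 \<le> pnorm x"
    and pnorm_eq_0_iff: "pnorm x = 0 \<longleftrightarrow> x = 0"
    and pnorm_mult: "pnorm (x * y) = pnorm x * pnorm y"
    and pnorm_ultrametric: "pnorm (x + y) \<le> max (pnorm x) (pnorm y)"
begin

definition pdist :: "'a \<Rightarrow> 'a \<Rightarrow> real" where
  "pdist x y = pnorm (x - y)"

lemma pnorm_minus: "pnorm (- x) = pnorm x"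
proof -
  have "pnorm (- x) * pnorm (- x) = pnorm x * pnorm x"
    by (simp flip: pnorm_mult)
  then show ?thesis
    using pnorm_nonneg[of x] pnorm_nonneg[of "- x"]
    by (simp flip: power2_eq_square)
qed

sublocale Metric_space UNIV pdist
proof
  fix x y z :: 'a
  show "0 \<le> pdist x y" by (simp add: pdist_def pnorm_nonneg)
  show "pdist x y = pdist y x"
    using pnorm_minus[of "x - y"] by (simp add: pdist_def)
  show "pdist x y = 0 \<longleftrightarrow> x = y" by (simp add: pdist_def pnorm_eq_0_iff)
  have "pnorm (x - z) \<le> max (pnorm (x - y)) (pnorm (y - z))"
    using pnorm_ultrametric[of "x - y" "y - z"] by simp
  then show "pdist x z \<le> pdist x y + pdist y z"
    using pnorm_nonneg[of "x - y"] pnorm_nonneg[of "y - z"]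
    by (simp add: pdist_def)
qed

text \<open>
  When the absolute value is complete and restricts to the p-adic one on the rationals, the
  topological closure of the rationals is the field of p-adic numbers.
\<close>

definition rat_completion :: "'a set" where
  "rat_completion = mtopology closure_of \<rat>"

definition algebraic_elements :: "'a set" where
  "algebraic_elements =
     {x. \<exists>f. f \<noteq> 0 \<and> (\<forall>i. coeff f i \<in> rat_completion) \<and> poly f x = 0}"

end

text \<open>
  A type depending on the prime p is not available, so the field of complex p-adic numbers is
  given by its defining property, which determines it up to isometric isomorphism: it is the
  completion of an algebraic closure of the field of p-adic numbers.  The normalisation
  at p and the ultrametric inequality force the absolute value to be the p-adic one on the
  rationals.
\<close>

locale complex_p_adic_field = nonarchimedean_field pnorm
  for p :: nat and pnorm :: "'a::field_char_0 \<Rightarrow> real" +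
  assumes prime_p: "prime p"
    and pnorm_p: "pnorm (of_nat p) = 1 / real p"
    and complete: "mcomplete"
    and algebraic_elements_closed:
      "\<lbrakk>\<And>i. coeff f i \<in> algebraic_elements; degree f > 0\<rbrakk>
        \<Longrightarrow> \<exists>x\<in>algebraic_elements. poly f x = 0"
    and algebraic_elements_dense: "mtopology closure_of algebraic_elements = UNIV"


section \<open>Stirling and Changhee numbers\<close>

definition egf_coeff :: "'a::field_char_0 fps \<Rightarrow> nat \<Rightarrow> 'a" where
  "egf_coeff F n = fact n * fps_nth F n"

definition S1 :: "nat \<Rightarrow> nat \<Rightarrow> int" where
  "S1 n k = coeff (\<Prod>i<n. [:- int i, 1:]) k"

lemma S1_generating:
  fixes x :: "'a::comm_ring_1"
  shows "(\<Prod>i<n. x - of_nat i) = (\<Sum>k\<le>n. of_int (S1 n k) * x ^ k)"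
proof (induction n)
  case 0
  then show ?case by (simp add: S1_def)
next
  case (Suc n)
  have rec: "S1 (Suc n) k = (case k of 0 \<Rightarrow> 0 | Suc j \<Rightarrow> S1 n j) - int n * S1 n k" for k
    by (simp add: S1_def mult.commute[of _ "[:- int n, 1:]"] coeff_pCons split: nat.split)
  have "degree (\<Prod>i<n. [:- int i, 1:]) \<le> n"
    using degree_prod_sum_le[of "{..<n}" "\<lambda>i. [:- int i, 1:]"] by simp
  then have "S1 n (Suc n) = 0"
    by (simp add: S1_def coeff_eq_0)
  then have top: "(\<Sum>k\<le>Suc n. of_int (S1 n k) * x ^ k) = (\<Sum>k\<le>n. of_int (S1 n k) * x ^ k)"
    by simp
  have "(\<Sum>k\<le>Suc n. of_int (S1 (Suc n) k) * x ^ k) =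
      (\<Sum>k\<le>Suc n. of_int (case k of 0 \<Rightarrow> 0 | Suc j \<Rightarrow> S1 n j) * x ^ k)
        - of_nat n * (\<Sum>k\<le>Suc n. of_int (S1 n k) * x ^ k)"
    unfolding sum_distrib_left sum_subtractf[symmetric]
    by (intro sum.cong) (simp_all add: rec algebra_simps)
  also have "\<dots> = x * (\<Sum>k\<le>n. of_int (S1 n k) * x ^ k)
        - of_nat n * (\<Sum>k\<le>n. of_int (S1 n k) * x ^ k)"
    unfolding top by (subst sum.atMost_Suc_shift) (simp add: sum_distrib_left mult_ac)
  finally show ?case
    by (simp add: Suc algebra_simps)
qed

definition degenerate_ffact :: "'a::field_char_0 \<Rightarrow> 'a \<Rightarrow> nat \<Rightarrow> 'a" where
  "degenerate_ffact l x n = (\<Prod>i<n. x - of_nat i * l)"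

text \<open>The formal power series \<open>(1 + l u) powr (x / l)\<close> in the variable \<open>u\<close>.\<close>

definition degenerate_exp :: "'a::field_char_0 \<Rightarrow> 'a \<Rightarrow> 'a fps" where
  "degenerate_exp l x = Abs_fps (\<lambda>m. degenerate_ffact l x m / fact m)"

lemma degenerate_exp_eq_binomial:
  assumes "l \<noteq> 0"
  shows "degenerate_exp l x = fps_compose (fps_binomial (x / l)) (fps_const l * fps_X)"
proof (rule fps_ext)
  fix n
  have "(\<Prod>i<n. x - of_nat i * l) = (\<Prod>i<n. l * (x / l - of_nat i))"
    by (intro prod.cong) (use assms in \<open>auto simp: field_simps\<close>)
  also have "\<dots> = l ^ n * (\<Prod>i<n. x / l - of_nat i)"
    by (simp add: prod.distrib)
  finally show "fps_nth (degenerate_exp l x) n =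
      fps_nth (fps_compose (fps_binomial (x / l)) (fps_const l * fps_X)) n"
    by (simp add: degenerate_exp_def degenerate_ffact_def gbinomial_prod_rev
        atLeast0LessThan fps_compose_linear)
qed

definition degenerate_S2 :: "'a::field_char_0 \<Rightarrow> nat \<Rightarrow> nat \<Rightarrow> 'a" where
  "degenerate_S2 l k m =
     egf_coeff (fps_const (1 / fact m) * (degenerate_exp l 1 - 1) ^ m) k"

text \<open>
  \<open>fps_ln 1\<close> is the series of \<open>log (1 + t)\<close>.  The denominator has constant
  term 2, so the division is multiplication by a genuine inverse.
\<close>

definition degenerate_Changhee :: "'a::field_char_0 \<Rightarrow> nat \<Rightarrow> nat \<Rightarrow> 'a" where
  "degenerate_Changhee l r n =
     egf_coeff ((2 / (1 + fps_compose (degenerate_exp l 1) (fps_ln 1))) ^ r) n"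

end

theory Submission
  imports Defs
begin

text \<open>
  Put \<open>e(t) = (1 + l t) powr (1 / l) - 1\<close>.  The generating function of the Changhee numbers is
  \<open>(1 + e / 2) powr (- r)\<close> evaluated at \<open>log (1 + t)\<close>.  Expanding the negative power by the binomial
  series brings in the powers of \<open>e\<close>, hence the degenerate Stirling numbers of the second kind, and
  the substitution brings in the powers of \<open>log (1 + t)\<close>, hence the Stirling numbers of the first
  kind.
\<close>

lemma S1_Suc_Suc: "S1 (Suc n) (Suc k) = S1 n k - int n * S1 n (Suc k)"
  by (simp add: S1_def mult.commute[of _ "[:- int n, 1:]"] coeff_pCons)

lemma S1_Suc_0: "S1 (Suc n) 0 = - int n * S1 n 0"
  by (simp add: S1_def mult.commute[of _ "[:- int n, 1:]"] coeff_pCons)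

lemma S1_0: "S1 n 0 = (if n = 0 then 1 else 0)"
proof (induction n)
  case 0
  show ?case by (simp add: S1_def)
next
  case (Suc n)
  then show ?case by (simp add: S1_Suc_0)
qed

text \<open>
  Differentiating \<open>(log (1 + t)) ^ (k + 1)\<close> and multiplying by \<open>1 + t\<close> gives the recurrence of the
  Stirling numbers on the level of coefficients.
\<close>

lemma fps_ln_power_nth_Suc:
  "of_nat (Suc n) * fps_nth (fps_ln (1::'a::field_char_0) ^ Suc k) (Suc n) =
     of_nat (Suc k) * fps_nth (fps_ln 1 ^ k) n - of_nat n * fps_nth (fps_ln 1 ^ Suc k) n"
proof -
  let ?L = "fps_ln (1::'a)"
  have "(1 + fps_X) * fps_deriv ?L = 1"
    using inverse_mult_eq_1'[of "1 + fps_X :: 'a fps"] by (simp add: fps_ln_deriv)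
  then have "(1 + fps_X) * fps_deriv (?L ^ Suc k) = of_nat (Suc k) * ?L ^ k"
    by (simp only: fps_deriv_power diff_Suc_1 fps_of_nat)
       (simp only: mult.left_commute mult.assoc, simp add: fps_of_nat mult_ac)
  then have "fps_nth ((1 + fps_X) * fps_deriv (?L ^ Suc k)) n = fps_nth (of_nat (Suc k) * ?L ^ k) n"
    by (rule arg_cong)
  then show ?thesis
    by (cases n) (simp_all add: distrib_right fps_deriv_nth fps_mult_of_nat_nth algebra_simps
        del: power_Suc of_nat_Suc)
qed

text \<open>Induction on \<open>n\<close>: scaled by factorials, the recurrence for the powers of
  the logarithm becomes \<open>S1_Suc_Suc\<close>. It lowers the exponent, so \<open>k\<close> stays
  arbitrary and the power 0 is treated apart.\<close>

lemma egf_coeff_fps_ln_power: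
  "egf_coeff (fps_ln (1::'a::field_char_0) ^ k) n = fact k * of_int (S1 n k)"
proof (induction n arbitrary: k)
  case 0
  have "S1 0 k = (if k = 0 then 1 else 0)"
    by (simp add: S1_def)
  then show ?case
    by (simp add: egf_coeff_def fps_power_zeroth)
next
  case (Suc n)
  show ?case
  proof (cases k)
    case 0
    then show ?thesis by (simp add: egf_coeff_def S1_0)
  next
    case (Suc j)
    let ?a = "\<lambda>i. fps_nth (fps_ln (1::'a) ^ i)"
    have "fact (Suc n) * ?a (Suc j) (Suc n) = fact n * (of_nat (Suc n) * ?a (Suc j) (Suc n))"
      by (simp del: power_Suc)
    also have "\<dots> = of_nat (Suc j) * egf_coeff (fps_ln 1 ^ j) n
        - of_nat n * egf_coeff (fps_ln 1 ^ Suc j) n"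
      unfolding fps_ln_power_nth_Suc egf_coeff_def by (simp add: algebra_simps del: power_Suc)
    also have "\<dots> = fact (Suc j) * of_int (S1 (Suc n) (Suc j))"
      unfolding Suc.IH by (simp add: S1_Suc_Suc algebra_simps)
    finally show ?thesis
      by (simp add: egf_coeff_def \<open>k = Suc j\<close> del: power_Suc)
  qed
qed

lemma egf_coeff_compose_fps_ln:
  "egf_coeff (F oo fps_ln (1::'a::field_char_0)) n =
     (\<Sum>k=0..n. egf_coeff F k * of_int (S1 n k))"
proof -
  have "egf_coeff (F oo fps_ln 1) n = (\<Sum>k=0..n. fps_nth F k * egf_coeff (fps_ln 1 ^ k) n)"
    by (simp add: egf_coeff_def fps_compose_nth sum_distrib_left mult_ac)
  also have "\<dots> = (\<Sum>k=0..n. egf_coeff F k * of_int (S1 n k))"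
    unfolding egf_coeff_fps_ln_power by (simp add: egf_coeff_def mult_ac)
  finally show ?thesis .
qed

lemma fps_binomial_minus_of_nat_nth:
  "fps_nth (fps_binomial (- of_nat r :: 'a::field_char_0)) m =
     (-1) ^ m * of_nat ((r + m - 1) choose m)"
proof (cases m)
  case (Suc j)
  \<comment> \<open>Here \<open>m\<close> is positive, so the truncated subtraction is exact. For
    \<open>m = 0\<close> both sides are 1, even when \<open>r = 0\<close>.\<close>
  have "(of_nat r + of_nat m - 1 :: 'a) = of_nat (r + m - 1)"
    by (simp add: Suc)
  then show ?thesis
    by (simp add: gbinomial_minus binomial_gbinomial)
qed simp

text \<open>The factor \<open>fact m\<close> cancels the \<open>1 / fact m\<close> built into
  \<open>degenerate_S2\<close>; the powers of 1/2 come from the inner series.\<close>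

lemma egf_coeff_negative_power_compose:
  "egf_coeff (fps_binomial (- of_nat r) oo (fps_const (1 / 2) * (degenerate_exp l 1 - 1))) k =
     (\<Sum>m=0..k. (-1) ^ m * fact m * of_nat ((r + m - 1) choose m) * (1 / 2 ^ m)
        * degenerate_S2 l k m)"
proof -
  have "fps_nth ((fps_const (1 / 2) * (degenerate_exp l 1 - 1)) ^ m) k =
      (1 / 2 ^ m) * fps_nth ((degenerate_exp l 1 - 1) ^ m) k" for m
    by (simp only: power_mult_distrib fps_const_power fps_mult_left_const_nth power_one_over)
  then show ?thesis
    unfolding egf_coeff_def degenerate_S2_def fps_compose_nth sum_distrib_left
      fps_binomial_minus_of_nat_nth
    by (intro sum.cong refl) (simp add: mult_ac)
qed

lemma Changhee_generating_function:
  fixes l :: "'a::field_char_0"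
  shows "(2 / (1 + (degenerate_exp l 1 oo fps_ln 1))) ^ r =
     (fps_binomial (- of_nat r) oo (fps_const (1 / 2) * (degenerate_exp l 1 - 1))) oo fps_ln 1"
proof -
  define L where "L = fps_ln (1::'a)"
  define D where "D = degenerate_exp l 1"
  define u where "u = fps_const (1 / 2) * (D - 1)"
  have L0: "fps_nth L 0 = 0"
    by (simp add: L_def)
  have D0: "fps_nth D 0 = 1"
    by (simp add: D_def degenerate_exp_def degenerate_ffact_def)
  have u0: "fps_nth u 0 = 0"
    by (simp add: u_def D0)
  have uL0: "fps_nth (u oo L) 0 = 0"
    by (simp add: u0)
  have two: "2 * fps_const (1 / 2) = (1 :: 'a fps)"
    by (simp add: numeral_fps_const)
  have "2 * u = D - 1"
    by (simp add: u_def two mult.assoc[symmetric])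
  then have "D = 1 + 2 * u"
    by simp
  then have "D oo L = 1 + 2 * (u oo L)"
    by (simp add: fps_compose_add_distrib fps_compose_mult_distrib[OF L0] numeral_fps_const)
  then have "1 + (D oo L) = 2 * (1 + (u oo L))"
    by simp
  then have "2 / (1 + (D oo L)) = 2 / (2 * (1 + (u oo L)))"
    by simp
  \<comment> \<open>After cancelling 2 the denominator has constant term 1, hence is a unit.\<close>
  also have "\<dots> = inverse (1 + (u oo L))"
    using div_mult_mult1[of 2 1 "1 + (u oo L)"] fps_divide_unit[of "1 + (u oo L)" 1] uL0
    by (simp del: div_mult_mult1 add: distrib_left)
  finally have "(2 / (1 + (D oo L))) ^ r = inverse ((1 + (u oo L)) ^ r)"
    by (simp add: fps_inverse_power)
  also have "\<dots> = inverse ((1 + fps_X) ^ r) oo (u oo L)"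
    by (simp add: fps_inverse_compose[OF uL0] fps_compose_power[OF uL0, symmetric]
        fps_compose_add_distrib fps_X_fps_compose_startby0[OF uL0])
  \<comment> \<open>The inverse power of \<open>1 + fps_X\<close> is the binomial series;
    reassociating is valid since \<open>u\<close> and \<open>L\<close> vanish at 0.\<close>
  also have "\<dots> = (fps_binomial (- of_nat r) oo u) oo L"
    by (simp add: fps_binomial_minus_of_nat fps_compose_assoc[OF L0 u0])
  finally show ?thesis
    by (simp add: u_def D_def L_def)
qed

theorem theorem2p12:
  fixes p :: nat and pnorm :: "'a::field_char_0 \<Rightarrow> real" and l :: 'a and n r :: nat
  assumes "prime p" and "odd p"
    and "complex_p_adic_field p pnorm"
    and "l \<noteq> 0" and "pnorm l \<le> 1"
  shows "degenerate_Changhee l r n =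
    (\<Sum>k=0..n. \<Sum>m=0..k.
       (-1) ^ m * fact m * of_nat ((r + m - 1) choose m) * (1 / 2 ^ m)
         * degenerate_S2 l k m * of_int (S1 n k))"
  unfolding degenerate_Changhee_def Changhee_generating_function egf_coeff_compose_fps_ln
    egf_coeff_negative_power_compose sum_distrib_right ..

end
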